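(* Let $\mathcal{G}=(V,E)$ be a directed graph with $N$ nodes and no dangling nodes, which is not strongly connected and has $M\ge1$ dangling clusters, and let $\lambda\in(0,1)$. Then: (i) $PR_\lambda:\Delta_N^+\to\Delta_N^+$ has some fixed point if and only if $\mathcal{G}$ has no non-dangling clusters. (ii) If $\mathcal{G}$ has some non-dangling clusters, then $PR_\lambda:\Delta_N\to\Delta_N$ has some fixed points. (iii) $PR_\lambda$ (as a map $\Delta_N\to\Delta_N$) has a unique fixed point if and only if $\mathcal{G}$ has only one dangling cluster. (iv) If $\mathcal{G}$ has $M>1$ dangling clusters, then the set of fixed points of $PR_\lambda$ in $\Delta_N$ (respectively, in $\Delta_N^+$) is the convex hull (respectively, the intersection of $\Delta_N^+$ with the convex hull) of the left-hand Perron vectors $\mathbf{c}_1,\dots,\mathbf{c}_M$ of the row-stochastic irreducible matrices $D_1,\dots,D_M$ corresponding to the dangling clusters, each $\mathbf{c}_j$ being regarded as a vector in $\mathbb{R}^{N\times1}$ by setting its entries equal to $0$ at all nodes outside the $j$-th dangling cluster.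
   Context: $\mathcal{G}=(V,E)$ is a directed graph with $V=\{1,\dots,N\}$ and adjacency matrix $A=(a_{ij})$, $a_{ij}=1$ if $(i,j)\in E$ and $0$ otherwise (self-loops are allowed). A dangling node is a node with no outgoing links; it is assumed there are none. $P_A=(p_{ij})$ is the row-stochastic matrix $p_{ij}=a_{ij}/\sum_k a_{ik}$. $\Delta_N^+=\{\mathbf{x}\in\mathbb{R}^{N\times1}: x_1+\cdots+x_N=1,\ x_i>0\ \forall i\}$ and $\Delta_N=\{\mathbf{x}\in\mathbb{R}^{N\times1}: x_1+\cdots+x_N=1,\ x_i\ge0\ \forall i\}$. For a damping factor $\lambda\in(0,1)$, the PageRank as a function of the personalization vector is $PR_\lambda(\mathbf{v})=\pi$ with $\pi^T=\mathbf{v}^TX(\lambda)$, $X(\lambda)=(1-\lambda)(I_N-\lambda P_A)^{-1}$; it maps $\Delta_N^+$ into $\Delta_N^+$ and $\Delta_N$ into $\Delta_N$. The clusters of $\mathcal{G}$ are its strongly connected components (the maximal sets of mutually reachable nodes, a single node being allowed). A dangling cluster is a cluster with no links from its nodes to nodes of other clusters; the other clusters are non-dangling. For the $j$-th dangling cluster, $D_j$ is the submatrix of $P_A$ with rows and columns indexed by its nodes (it is irreducible and row-stochastic). Left-hand Perron vector: for a non-negative irreducible matrix $M$, the unique vector $\mathbf{q}$ with $\mathbf{q}^TM=\rho(M)\mathbf{q}^T$, $\mathbf{q}>0$, and entries summing to $1$, where $\rho(M)$ is the spectral radius. *)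

theory Defs
  imports
    "Graph_Theory.Graph_Theory"
    "Jordan_Normal_Form.Gauss_Jordan_Elimination"
    "Jordan_Normal_Form.Spectral_Radius"
    "Jordan_Normal_Form.DL_Submatrix"
begin

text \<open>
  A directed graph with \<open>N\<close> nodes has node set \<open>{..<N}\<close> instead of \<open>{1, \<dots>, N}\<close>, because the
  entries of matrices and vectors are numbered from 0. Self-loops are allowed.
\<close>

definition dangling_node :: "nat pair_pre_digraph \<Rightarrow> nat \<Rightarrow> bool" where
  "dangling_node G u \<longleftrightarrow> u \<in> pverts G \<and> out_arcs (with_proj G) u = {}"

abbreviation clusters :: "nat pair_pre_digraph \<Rightarrow> nat set set" where
  "clusters G \<equiv> pre_digraph.sccs_verts (with_proj G)"

definition dangling_clusters :: "nat pair_pre_digraph \<Rightarrow> nat set set" where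
  "dangling_clusters G = {C \<in> clusters G. \<forall>u v. (u, v) \<in> parcs G \<longrightarrow> u \<in> C \<longrightarrow> v \<in> C}"

definition non_dangling_clusters :: "nat pair_pre_digraph \<Rightarrow> nat set set" where
  "non_dangling_clusters G = clusters G - dangling_clusters G"

definition adjacency_mat :: "nat pair_pre_digraph \<Rightarrow> real mat" where
  "adjacency_mat G = (let N = card (pverts G) in
     mat N N (\<lambda>(i, j). if (i, j) \<in> parcs G then 1 else 0))"

definition transition_mat :: "nat pair_pre_digraph \<Rightarrow> real mat" where
  "transition_mat G = (let N = card (pverts G); A = adjacency_mat G in
     mat N N (\<lambda>(i, j). A $$ (i, j) / (\<Sum>k<N. A $$ (i, k))))"

definition prob_simplex :: "nat \<Rightarrow> real vec set" where
  "prob_simplex n = {x \<in> carrier_vec n. (\<Sum>i<n. x $ i) = 1 \<and> (\<forall>i<n. x $ i \<ge> 0)}"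

definition open_prob_simplex :: "nat \<Rightarrow> real vec set" where
  "open_prob_simplex n = {x \<in> carrier_vec n. (\<Sum>i<n. x $ i) = 1 \<and> (\<forall>i<n. x $ i > 0)}"

definition resolvent_mat :: "nat pair_pre_digraph \<Rightarrow> real \<Rightarrow> real mat" where
  "resolvent_mat G lam = (let N = card (pverts G) in
     (1 - lam) \<cdot>\<^sub>m the (mat_inverse (1\<^sub>m N - lam \<cdot>\<^sub>m transition_mat G)))"

text \<open>Row vectors are rendered by transposition: \<open>\<pi>\<^sup>T = v\<^sup>T X\<close> is \<open>\<pi> = X\<^sup>T v\<close>.\<close>

definition pagerank :: "nat pair_pre_digraph \<Rightarrow> real \<Rightarrow> real vec \<Rightarrow> real vec" where
  "pagerank G lam v = transpose_mat (resolvent_mat G lam) *\<^sub>v v"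

definition fixed_points :: "('a \<Rightarrow> 'a) \<Rightarrow> 'a set \<Rightarrow> 'a set" where
  "fixed_points f S = {x \<in> S. f x = x}"

text \<open>Only meaningful for non-negative irreducible square matrices, where the vector exists uniquely.\<close>

definition left_perron_vec :: "real mat \<Rightarrow> real vec" where
  "left_perron_vec D = (THE q. q \<in> carrier_vec (dim_row D) \<and>
     transpose_mat D *\<^sub>v q = spectral_radius (map_mat complex_of_real D) \<cdot>\<^sub>v q \<and>
     (\<forall>i<dim_row D. q $ i > 0) \<and> (\<Sum>i<dim_row D. q $ i) = 1)"

definition cluster_mat :: "nat pair_pre_digraph \<Rightarrow> nat set \<Rightarrow> real mat" where
  "cluster_mat G C = submatrix (transition_mat G) C C"

text \<open>
  The submatrix numbers the nodes of \<open>C\<close> increasingly, so node \<open>i \<in> C\<close> carries the number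
  \<open>card {k \<in> C. k < i}\<close>.
\<close>

definition extend_by_zero :: "nat \<Rightarrow> nat set \<Rightarrow> real vec \<Rightarrow> real vec" where
  "extend_by_zero n C q = vec n (\<lambda>i. if i \<in> C then q $ card {k \<in> C. k < i} else 0)"

definition cluster_perron_vec :: "nat pair_pre_digraph \<Rightarrow> nat set \<Rightarrow> real vec" where
  "cluster_perron_vec G C =
     extend_by_zero (card (pverts G)) C (left_perron_vec (cluster_mat G C))"

text \<open>
  The type of vectors of varying dimension is not a real vector space, so convexity and the convex
  hull are spelled out relative to \<open>carrier_vec n\<close>, as in \<open>HOL-Analysis\<close>.
\<close>

definition convex_vecs :: "nat \<Rightarrow> real vec set \<Rightarrow> bool" where
  "convex_vecs n S \<longleftrightarrow> S \<subseteq> carrier_vec n \<and>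
     (\<forall>x\<in>S. \<forall>y\<in>S. \<forall>a\<ge>0. \<forall>b\<ge>0. a + b = 1 \<longrightarrow> a \<cdot>\<^sub>v x + b \<cdot>\<^sub>v y \<in> S)"

definition convex_hull_vecs :: "nat \<Rightarrow> real vec set \<Rightarrow> real vec set" where
  "convex_hull_vecs n S = convex_vecs n hull S"

end

theory Submission
  imports Defs
begin

text \<open>
  Since \<open>X(\<lambda>)\<close> is a multiple of the inverse of \<open>I - \<lambda> P\<close>, a vector is fixed by PageRank iff it is a
  stationary vector of \<open>P\<close>. Counting the mass that enters a set of nodes closed under links shows that a
  nonnegative stationary vector puts no mass on a node that leads into a closed set not containing it.
  So it vanishes on the non-dangling clusters, and its restriction to each dangling cluster is
  stationary there, hence a multiple of the Perron vector of that cluster.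
\<close>

section \<open>Stationary vectors of stochastic kernels\<close>

text \<open>Stationarity is stated for functions on an arbitrary index set, so that the kernel of
  the whole graph can be restricted to a cluster whose nodes keep their names. The renumbering
  hidden in \<open>cluster_mat\<close> is handled separately, through the bijection
  \<open>pick C\<close>.

  A Perron vector is given by a definite description, so its existence and uniqueness have to be
  proved for each dangling cluster. Both rest on one fact: the absolute values of a stationary
  vector are again stationary. Existence applies it to a left eigenvector for 1, uniqueness to the
  difference of two candidates.

  One bound on eigenvalues serves twice. Over the reals it excludes \<open>1 / lam\<close>, which
  makes I - \<open>lam\<close> P invertible; over the complex numbers it yields spectral radius 1,
  which turns the Perron equation into stationarity.\<close>

definition stationary_on :: "'a set \<Rightarrow> ('a \<Rightarrow> 'a \<Rightarrow> real) \<Rightarrow> ('a \<Rightarrow> real) \<Rightarrow> bool" where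
  "stationary_on S p x \<longleftrightarrow> (\<forall>j\<in>S. (\<Sum>i\<in>S. x i * p i j) = x j)"

lemma stationary_on_scale: "stationary_on S p x \<Longrightarrow> stationary_on S p (\<lambda>i. a * x i)"
  by (simp add: stationary_on_def mult.assoc flip: sum_distrib_left)

lemma stationary_on_add:
  "stationary_on S p x \<Longrightarrow> stationary_on S p y \<Longrightarrow> stationary_on S p (\<lambda>i. x i + y i)"
  by (simp add: stationary_on_def distrib_right sum.distrib)

lemma stationary_on_diff:
  "stationary_on S p x \<Longrightarrow> stationary_on S p y \<Longrightarrow> stationary_on S p (\<lambda>i. x i - y i)"
  by (simp add: stationary_on_def left_diff_distrib sum_subtractf)

lemma stationary_on_sum:
  assumes "\<And>k. k \<in> K \<Longrightarrow> stationary_on S p (x k)"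
  shows "stationary_on S p (\<lambda>i. \<Sum>k\<in>K. x k i)"
proof -
  have "(\<Sum>i\<in>S. (\<Sum>k\<in>K. x k i) * p i j) = (\<Sum>k\<in>K. x k j)" if "j \<in> S" for j
  proof -
    have "(\<Sum>i\<in>S. (\<Sum>k\<in>K. x k i) * p i j) = (\<Sum>k\<in>K. \<Sum>i\<in>S. x k i * p i j)"
      by (simp add: sum_distrib_right sum.swap[of _ K])
    also have "\<dots> = (\<Sum>k\<in>K. x k j)"
      using assms that by (intro sum.cong) (auto simp: stationary_on_def)
    finally show ?thesis .
  qed
  then show ?thesis by (simp add: stationary_on_def)
qed

lemma stationary_on_cong:
  assumes "\<And>i. i \<in> S \<Longrightarrow> x i = y i" "\<And>i j. i \<in> S \<Longrightarrow> j \<in> S \<Longrightarrow> p i j = q i j"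
  shows "stationary_on S p x \<longleftrightarrow> stationary_on S q y"
  using assms by (simp add: stationary_on_def)

lemma stationary_on_reindex:
  assumes "bij_betw f S T"
  shows "stationary_on T p x \<longleftrightarrow> stationary_on S (\<lambda>i j. p (f i) (f j)) (\<lambda>i. x (f i))"
proof -
  have "(\<Sum>i\<in>T. x i * p i j) = (\<Sum>i\<in>S. x (f i) * p (f i) j)" for j
    using assms by (rule sum.reindex_bij_betw[symmetric])
  moreover have "T = f ` S" using assms by (simp add: bij_betw_def)
  ultimately show ?thesis by (simp add: stationary_on_def)
qed

section \<open>Mass balance for finite stochastic kernels\<close>

locale stochastic_kernel =
  fixes S :: "'a set" and p :: "'a \<Rightarrow> 'a \<Rightarrow> real"
  assumes finite_S: "finite S"
    and p_nonneg: "\<And>i j. i \<in> S \<Longrightarrow> j \<in> S \<Longrightarrow> 0 \<le> p i j"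
    and p_sum: "\<And>i. i \<in> S \<Longrightarrow> (\<Sum>j\<in>S. p i j) = 1"
begin

lemma sum_push: "(\<Sum>j\<in>S. \<Sum>i\<in>S. x i * p i j) = (\<Sum>i\<in>S. x i)"
proof -
  have "(\<Sum>j\<in>S. \<Sum>i\<in>S. x i * p i j) = (\<Sum>i\<in>S. x i * (\<Sum>j\<in>S. p i j))"
    by (subst sum.swap) (simp add: sum_distrib_left)
  then show ?thesis by (simp add: p_sum)
qed

text \<open>Each entry of \<open>|x|P - |x|\<close> is nonnegative by the triangle inequality, and the entries sum to 0.\<close>

lemma stationary_on_abs:
  assumes "stationary_on S p x"
  shows "stationary_on S p (\<lambda>i. \<bar>x i\<bar>)"
proof -
  let ?d = "\<lambda>j. (\<Sum>i\<in>S. \<bar>x i\<bar> * p i j) - \<bar>x j\<bar>"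
  have nonneg: "0 \<le> ?d j" if "j \<in> S" for j
  proof -
    have "\<bar>x j\<bar> = \<bar>\<Sum>i\<in>S. x i * p i j\<bar>"
      using assms that by (simp add: stationary_on_def)
    also have "\<dots> \<le> (\<Sum>i\<in>S. \<bar>x i * p i j\<bar>)" by (rule sum_abs)
    also have "\<dots> = (\<Sum>i\<in>S. \<bar>x i\<bar> * p i j)"
      using that by (intro sum.cong) (auto simp: abs_mult p_nonneg)
    finally show ?thesis by simp
  qed
  have "(\<Sum>j\<in>S. ?d j) = 0" by (simp add: sum_subtractf sum_push)
  then have "?d j = 0" if "j \<in> S" for j
    using sum_nonneg_eq_0_iff[OF finite_S, of ?d] nonneg that by blast
  then show ?thesis by (simp add: stationary_on_def)
qed

text \<open>A vanishing entry of a nonnegative stationary vector is a sum of nonnegative terms, so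
  every predecessor through a positive entry of \<open>p\<close> vanishes as well. The path is
  followed from its end back to its start.\<close>

lemma stationary_on_zero_backwards:
  assumes x: "stationary_on S p x" and nonneg: "\<And>i. i \<in> S \<Longrightarrow> 0 \<le> x i"
    and reach: "(u, v) \<in> rtrancl_on S {(i, j). 0 < p i j}" and "x v = 0"
  shows "x u = 0"
  using reach
proof (induction rule: converse_rtrancl_on_induct)
  case base
  show ?case by fact
next
  case (step i j)
  have "(\<Sum>k\<in>S. x k * p k j) = 0"
    using x step by (simp add: stationary_on_def)
  then have "\<forall>k\<in>S. x k * p k j = 0"
    using sum_nonneg_eq_0_iff[OF finite_S, of "\<lambda>k. x k * p k j"] nonneg p_nonneg step by simp
  then have "x i * p i j = 0" using step by blast
  then show ?case using step by simp
qed

text \<open>Compare the mass of \<open>T\<close> before and after one step. No mass leaves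
  \<open>T\<close>, so what is there is kept in full, and stationarity forces the inflow from
  \<open>S - T\<close> to be 0. The inflow is a sum of nonnegative terms, and in the term of
  \<open>i\<close> the factor of \<open>x i\<close> is positive.\<close>

lemma stationary_on_zero_into_closed:
  assumes x: "stationary_on S p x" and nonneg: "\<And>i. i \<in> S \<Longrightarrow> 0 \<le> x i"
    and T: "T \<subseteq> S" and closed: "\<And>i j. i \<in> T \<Longrightarrow> j \<in> S - T \<Longrightarrow> p i j = 0"
    and i: "i \<in> S - T" and j: "j \<in> T" and pos: "0 < p i j"
  shows "x i = 0"
proof -
  have finT: "finite T" using T finite_S finite_subset by blast
  have one: "(\<Sum>j\<in>T. p i j) = 1" if "i \<in> T" for i
    using that T closed p_sum[of i] sum.mono_neutral_left[OF finite_S T, of "p i"] by auto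
  have "(\<Sum>j\<in>T. x j) = (\<Sum>j\<in>T. \<Sum>i\<in>S. x i * p i j)"
    using x T by (intro sum.cong) (auto simp: stationary_on_def)
  \<comment> \<open>The arriving mass is sorted by its source; the inner sum is the probability of
    stepping from \<open>i\<close> into \<open>T\<close>.\<close>
  also have "\<dots> = (\<Sum>i\<in>S. x i * (\<Sum>j\<in>T. p i j))"
    by (subst sum.swap) (simp add: sum_distrib_left)
  also have "\<dots> = (\<Sum>i\<in>S - T. x i * (\<Sum>j\<in>T. p i j)) + (\<Sum>i\<in>T. x i * (\<Sum>j\<in>T. p i j))"
    by (rule sum.subset_diff[OF T finite_S])
  also have "(\<Sum>i\<in>T. x i * (\<Sum>j\<in>T. p i j)) = (\<Sum>i\<in>T. x i)"
    by (simp add: one)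
  finally have "(\<Sum>i\<in>S - T. x i * (\<Sum>j\<in>T. p i j)) = 0" by simp
  moreover have "0 \<le> x k * (\<Sum>j\<in>T. p k j)" if "k \<in> S - T" for k
    using that T nonneg p_nonneg by (intro mult_nonneg_nonneg sum_nonneg) auto
  ultimately have "x i * (\<Sum>j\<in>T. p i j) = 0"
    using sum_nonneg_eq_0_iff[of "S - T" "\<lambda>k. x k * (\<Sum>j\<in>T. p k j)"] i finite_S by auto
  moreover have "0 < (\<Sum>j\<in>T. p i j)"
    using finT j pos i T p_nonneg by (intro sum_pos2[of T j]) auto
  ultimately show ?thesis by simp
qed

text \<open>Restricting the balance at \<open>j\<close> drops only the sources outside
  \<open>T\<close>. Such a source either has no transition to \<open>j\<close>, or feeds the closed
  set and therefore carries no mass.\<close>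

lemma stationary_on_restrict_closed:
  assumes x: "stationary_on S p x" and nonneg: "\<And>i. i \<in> S \<Longrightarrow> 0 \<le> x i"
    and T: "T \<subseteq> S" and closed: "\<And>i j. i \<in> T \<Longrightarrow> j \<in> S - T \<Longrightarrow> p i j = 0"
  shows "stationary_on T p x"
  unfolding stationary_on_def
proof
  fix j assume j: "j \<in> T"
  have "x i * p i j = 0" if "i \<in> S - T" for i
    using stationary_on_zero_into_closed[OF x nonneg T closed that j] p_nonneg[of i j] that j T
    by (cases "p i j = 0") auto
  then have "(\<Sum>i\<in>T. x i * p i j) = (\<Sum>i\<in>S. x i * p i j)"
    by (intro sum.mono_neutral_left finite_S T) auto
  then show "(\<Sum>i\<in>T. x i * p i j) = x j"
    using x j T by (auto simp: stationary_on_def)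
qed

lemma stationary_on_extend_closed:
  assumes x: "stationary_on T p x" and zero: "\<And>i. i \<in> S - T \<Longrightarrow> x i = 0"
    and T: "T \<subseteq> S" and closed: "\<And>i j. i \<in> T \<Longrightarrow> j \<in> S - T \<Longrightarrow> p i j = 0"
  shows "stationary_on S p x"
  unfolding stationary_on_def
proof
  fix j assume j: "j \<in> S"
  have "(\<Sum>i\<in>T. x i * p i j) = (\<Sum>i\<in>S. x i * p i j)"
    using zero by (intro sum.mono_neutral_left finite_S T) auto
  moreover have "(\<Sum>i\<in>T. x i * p i j) = x j"
  proof (cases "j \<in> T")
    case True
    then show ?thesis using x by (simp add: stationary_on_def)
  next
    case False
    then show ?thesis using j zero closed by (simp add: sum.neutral)
  qed
  ultimately show "(\<Sum>i\<in>S. x i * p i j) = x j" by simp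
qed

lemma stochastic_kernel_closed:
  assumes T: "T \<subseteq> S" and closed: "\<And>i j. i \<in> T \<Longrightarrow> j \<in> S - T \<Longrightarrow> p i j = 0"
  shows "stochastic_kernel T p"
proof
  show "finite T" using T finite_S finite_subset by blast
  show "0 \<le> p i j" if "i \<in> T" "j \<in> T" for i j using that T p_nonneg by blast
  show "(\<Sum>j\<in>T. p i j) = 1" if "i \<in> T" for i
    using that T closed p_sum[of i] sum.mono_neutral_left[OF finite_S T, of "p i"] by auto
qed

text \<open>At an index \<open>m\<close> where \<open>norm (v m)\<close> is largest, the equation
  bounds \<open>norm k * norm (v m)\<close> by a weighted average of norms, hence by
  \<open>norm (v m)\<close>. The field is left general because both the real and the complex case
  are used.\<close>

lemma eigenvalue_norm_le_1:
  fixes v :: "'a \<Rightarrow> 'b :: real_normed_field"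
  assumes eq: "\<And>i. i \<in> S \<Longrightarrow> (\<Sum>j\<in>S. of_real (p i j) * v j) = k * v i"
    and k: "k0 \<in> S" "v k0 \<noteq> 0"
  shows "norm k \<le> 1"
proof -
  obtain m where m: "m \<in> S" and max: "\<And>i. i \<in> S \<Longrightarrow> norm (v i) \<le> norm (v m)"
    using obtains_MAX[OF finite_S, of "\<lambda>i. norm (v i)"] k
    by (metis (no_types, lifting) Max_ge empty_iff finite_S finite_imageI image_eqI)
  have "norm k * norm (v m) = norm (\<Sum>j\<in>S. of_real (p m j) * v j)"
    by (simp add: eq m norm_mult)
  also have "\<dots> \<le> (\<Sum>j\<in>S. norm (of_real (p m j) * v j))" by (rule norm_sum)
  also have "\<dots> \<le> (\<Sum>j\<in>S. p m j * norm (v m))"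
    using m max p_nonneg by (intro sum_mono) (auto simp: norm_mult intro!: mult_left_mono)
  also have "\<dots> = norm (v m)" using m by (simp add: p_sum flip: sum_distrib_right)
  finally have "norm k * norm (v m) \<le> 1 * norm (v m)" by simp
  moreover have "0 < norm (v m)" using k max[of k0] by (meson less_le_trans zero_less_norm_iff)
  ultimately show ?thesis by (simp only: mult_le_cancel_right_pos)
qed

end

section \<open>Irreducible kernels: positivity and uniqueness\<close>

locale irreducible_stochastic_kernel = stochastic_kernel +
  assumes irreducible: "\<And>i j. i \<in> S \<Longrightarrow> j \<in> S \<Longrightarrow> (i, j) \<in> rtrancl_on S {(i, j). 0 < p i j}"
begin

text \<open>Every node leads to any node where \<open>x\<close> vanishes, so a single zero spreads
  backwards to all of \<open>S\<close>.\<close>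

lemma stationary_on_nonneg_cases:
  assumes "stationary_on S p x" "\<And>i. i \<in> S \<Longrightarrow> 0 \<le> x i"
  shows "(\<forall>i\<in>S. x i = 0) \<or> (\<forall>i\<in>S. 0 < x i)"
  using stationary_on_zero_backwards[OF assms irreducible] assms(2)
  by (metis order_less_le)

text \<open>
  The difference \<open>v = x - y\<close> has sum 0, and \<open>|v| + v\<close> is a nonnegative stationary vector: if it vanishes,
  then \<open>v \<le> 0\<close>; if it is positive, then \<open>v > 0\<close>.
\<close>

lemma stationary_on_unique:
  assumes x: "stationary_on S p x" and y: "stationary_on S p y"
    and sums: "(\<Sum>i\<in>S. x i) = (\<Sum>i\<in>S. y i)" and i: "i \<in> S"
  shows "x i = y i"
proof -
  let ?v = "\<lambda>i. x i - y i"
  have sum0: "(\<Sum>i\<in>S. ?v i) = 0" using sums by (simp add: sum_subtractf)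
  have v: "stationary_on S p ?v" using x y by (rule stationary_on_diff)
  have "stationary_on S p (\<lambda>i. \<bar>?v i\<bar> + ?v i)" "\<And>i. i \<in> S \<Longrightarrow> 0 \<le> \<bar>?v i\<bar> + ?v i"
    using stationary_on_add[OF stationary_on_abs[OF v] v] by auto
  then consider "\<forall>i\<in>S. \<bar>?v i\<bar> + ?v i = 0" | "\<forall>i\<in>S. 0 < \<bar>?v i\<bar> + ?v i"
    using stationary_on_nonneg_cases[of "\<lambda>i. \<bar>?v i\<bar> + ?v i"] by blast
  then show ?thesis
  proof cases
    case 1
    then have "(\<Sum>i\<in>S. \<bar>?v i\<bar> + ?v i) = 0" by (rule sum.neutral)
    then have "(\<Sum>i\<in>S. \<bar>?v i\<bar>) = 0" using sum0 by (simp only: sum.distrib)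
    then have "\<bar>?v i\<bar> = 0" using sum_nonneg_eq_0_iff[OF finite_S, of "\<lambda>i. \<bar>?v i\<bar>"] i by simp
    then show ?thesis by simp
  next
    case 2
    then have "0 < ?v i" if "i \<in> S" for i using 2 that by fastforce
    then have "0 < (\<Sum>i\<in>S. ?v i)" using i finite_S by (intro sum_pos) auto
    then show ?thesis using sum0 by simp
  qed
qed

end

section \<open>Stochastic matrices\<close>

lemma smult_mat_mult_vec:
  fixes A :: "'a :: comm_semiring_0 mat"
  assumes "A \<in> carrier_mat nr nc" "v \<in> carrier_vec nc"
  shows "(k \<cdot>\<^sub>m A) *\<^sub>v v = k \<cdot>\<^sub>v (A *\<^sub>v v)"
  using assms by (intro eq_vecI) (auto simp: scalar_prod_def sum_distrib_left mult.assoc)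

lemma exists_vec_index_nonzero:
  assumes "v \<in> carrier_vec n" "v \<noteq> 0\<^sub>v n"
  obtains i where "i < n" "v $ i \<noteq> 0"
  using assms eq_vecI[of v "0\<^sub>v n"] by auto

lemma mult_mat_vec_transpose_index:
  fixes A :: "real mat"
  assumes "A \<in> carrier_mat n n" "v \<in> carrier_vec n" "j < n"
  shows "(transpose_mat A *\<^sub>v v) $ j = (\<Sum>i<n. v $ i * A $$ (i, j))"
  using assms by (auto simp: scalar_prod_def atLeast0LessThan mult.commute intro!: sum.cong)

lemma stationary_on_iff_transpose:
  assumes A: "A \<in> carrier_mat n n" and v: "v \<in> carrier_vec n"
  shows "stationary_on {..<n} (\<lambda>i j. A $$ (i, j)) (($) v) \<longleftrightarrow> transpose_mat A *\<^sub>v v = v"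
proof -
  have "transpose_mat A *\<^sub>v v = v \<longleftrightarrow> (\<forall>j<n. (transpose_mat A *\<^sub>v v) $ j = v $ j)"
    using A v by (subst vec_eq_iff) auto
  also have "\<dots> \<longleftrightarrow> (\<forall>j<n. (\<Sum>i<n. v $ i * A $$ (i, j)) = v $ j)"
    by (simp only: mult_mat_vec_transpose_index[OF A v] cong: imp_cong)
  finally show ?thesis by (simp add: stationary_on_def Ball_def)
qed

locale stochastic_mat =
  fixes n :: nat and A :: "real mat"
  assumes A: "A \<in> carrier_mat n n"
    and kernel: "stochastic_kernel {..<n} (\<lambda>i j. A $$ (i, j))"
begin

sublocale stochastic_kernel "{..<n}" "\<lambda>i j. A $$ (i, j)" by (rule kernel)

lemma eigenvector_ones:
  assumes "0 < n"
  shows "eigenvector (map_mat (of_real :: real \<Rightarrow> 'b :: real_normed_field) A) (vec n (\<lambda>_. 1)) 1"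
proof -
  have "map_mat of_real A *\<^sub>v vec n (\<lambda>_. 1 :: 'b) = 1 \<cdot>\<^sub>v vec n (\<lambda>_. 1)"
  proof (rule eq_vecI)
    fix i assume "i < dim_vec (1 \<cdot>\<^sub>v vec n (\<lambda>_. 1 :: 'b))"
    then have i: "i < n" by simp
    have "(map_mat of_real A *\<^sub>v vec n (\<lambda>_. 1 :: 'b)) $ i = of_real (\<Sum>j<n. A $$ (i, j))"
      using A i by (simp add: scalar_prod_def atLeast0LessThan)
    then show "(map_mat of_real A *\<^sub>v vec n (\<lambda>_. 1 :: 'b)) $ i = (1 \<cdot>\<^sub>v vec n (\<lambda>_. 1)) $ i"
      using i p_sum[of i] by simp
  qed (use A in simp)
  moreover have "vec n (\<lambda>_. 1 :: 'b) \<noteq> 0\<^sub>v n"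
  proof
    assume "vec n (\<lambda>_. 1 :: 'b) = 0\<^sub>v n"
    then have "vec n (\<lambda>_. 1 :: 'b) $ 0 = 0\<^sub>v n $ 0" by simp
    then show False using assms by simp
  qed
  ultimately show ?thesis using A by (simp add: eigenvector_def)
qed

lemma eigenvalue_mat_norm_le_1:
  fixes k :: "'b :: real_normed_field"
  assumes "eigenvalue (map_mat of_real A) k"
  shows "norm k \<le> 1"
proof -
  obtain v where v: "v \<in> carrier_vec n" "v \<noteq> 0\<^sub>v n" "map_mat of_real A *\<^sub>v v = k \<cdot>\<^sub>v v"
    using assms A by (auto simp: eigenvalue_def eigenvector_def)
  have "(\<Sum>j<n. of_real (A $$ (i, j)) * v $ j) = k * v $ i" if "i < n" for i
  proof -
    have "(map_mat of_real A *\<^sub>v v) $ i = (\<Sum>j<n. of_real (A $$ (i, j)) * v $ j)"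
      using A v(1) that by (simp add: scalar_prod_def atLeast0LessThan)
    then show ?thesis using v that by simp
  qed
  moreover obtain k0 where "k0 < n" "v $ k0 \<noteq> 0"
    using v(1,2) by (rule exists_vec_index_nonzero)
  ultimately show ?thesis by (intro eigenvalue_norm_le_1[of "($) v" k k0]) auto
qed

lemma spectral_radius_eq_1:
  assumes n: "0 < n"
  shows "spectral_radius (map_mat complex_of_real A) = 1"
proof (rule antisym)
  let ?A = "map_mat complex_of_real A"
  have A': "?A \<in> carrier_mat n n" using A by simp
  show "spectral_radius ?A \<le> 1"
    using spectral_radius_mem_max(1)[OF A' n] unfolding spectrum_def
    by (elim imageE) (simp add: eigenvalue_mat_norm_le_1)
  have "1 \<in> spectrum ?A"
    using eigenvector_ones[OF n] unfolding spectrum_def eigenvalue_def by blast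
  then show "1 \<le> spectral_radius ?A"
    by (intro spectral_radius_mem_max(2)[OF A' n]) (auto intro: rev_image_eqI)
qed

text \<open>The all-ones vector makes 1 an eigenvalue of \<open>A\<close>, and the transpose has the
  same characteristic polynomial, so a left eigenvector for 1 exists too. Its signs are unknown, but
  its absolute values are stationary again and can be divided by their sum.\<close>

lemma exists_stationary:
  assumes n: "0 < n"
  obtains x where "stationary_on {..<n} (\<lambda>i j. A $$ (i, j)) x"
    "\<And>i. i < n \<Longrightarrow> 0 \<le> x i" "(\<Sum>i<n. x i) = 1"
proof -
  have id: "map_mat of_real A = A" by (intro eq_matI) auto
  have "eigenvalue A 1"
    using eigenvector_ones[OF n, where 'b = real] unfolding id eigenvalue_def by blast
  then have "eigenvalue (transpose_mat A) 1"
    using A eigenvalue_root_char_poly[of A n] eigenvalue_root_char_poly[of "transpose_mat A" n]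
    by simp
  then obtain v where v: "v \<in> carrier_vec n" "v \<noteq> 0\<^sub>v n" "transpose_mat A *\<^sub>v v = v"
    using A by (auto simp: eigenvalue_def eigenvector_def)
  let ?s = "\<Sum>i<n. \<bar>v $ i\<bar>"
  obtain k where k: "k < n" "v $ k \<noteq> 0"
    using v(1,2) by (rule exists_vec_index_nonzero)
  then have s: "0 < ?s" by (intro sum_pos2[of _ k]) auto
  have "stationary_on {..<n} (\<lambda>i j. A $$ (i, j)) (\<lambda>i. \<bar>v $ i\<bar>)"
    using stationary_on_abs v stationary_on_iff_transpose[OF A v(1)] by blast
  from stationary_on_scale[OF this, of "1 / ?s"]
  show thesis using s by (intro that) (auto simp flip: sum_divide_distrib)
qed

text \<open>Put \<open>B = I - lam A\<close>. Multiplying the fixed-point equation by the transpose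
  of \<open>B\<close> gives \<open>B^T v = (1 - lam) v\<close>, that is
  \<open>lam A^T v = lam v\<close>, and \<open>lam\<close> cancels. Invertibility of
  \<open>B\<close> also ensures that \<open>the (mat_inverse _)\<close> really denotes the
  inverse.\<close>

lemma resolvent_fixed_iff:
  assumes lam: "0 < lam" "lam < 1" and v: "v \<in> carrier_vec n"
  shows "transpose_mat ((1 - lam) \<cdot>\<^sub>m the (mat_inverse (1\<^sub>m n - lam \<cdot>\<^sub>m A))) *\<^sub>v v = v \<longleftrightarrow>
    transpose_mat A *\<^sub>v v = v"
proof -
  define B where "B = 1\<^sub>m n - lam \<cdot>\<^sub>m A"
  have B: "B \<in> carrier_mat n n" using A by (auto simp: B_def)
  \<comment> \<open>A nonzero vector killed by \<open>B\<close> would be an eigenvector of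
    \<open>A\<close> for \<open>1 / lam\<close>, which exceeds 1.\<close>
  have "det B \<noteq> 0"
  proof
    assume "det B = 0"
    then obtain w where w: "w \<in> carrier_vec n" "w \<noteq> 0\<^sub>v n" "B *\<^sub>v w = 0\<^sub>v n"
      using det_0_iff_vec_prod_zero[OF B] by auto
    have "A *\<^sub>v w = (1 / lam) \<cdot>\<^sub>v w"
    proof (rule eq_vecI)
      fix i assume "i < dim_vec ((1 / lam) \<cdot>\<^sub>v w)"
      then have i: "i < n" using w by simp
      have "B *\<^sub>v w = w - lam \<cdot>\<^sub>v (A *\<^sub>v w)"
        using A w by (simp add: B_def minus_mult_distrib_mat_vec[of _ n n] smult_mat_mult_vec[of _ n n])
      from trans[OF this[symmetric] w(3)] i have "(w - lam \<cdot>\<^sub>v (A *\<^sub>v w)) $ i = 0"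
        by simp
      then have "w $ i = lam * (A *\<^sub>v w) $ i" using A i w(1) by simp
      then show "(A *\<^sub>v w) $ i = ((1 / lam) \<cdot>\<^sub>v w) $ i" using lam i w(1) by simp
    qed (use A w in simp)
    then have "eigenvalue A (1 / lam)"
      using A w by (auto simp: eigenvalue_def eigenvector_def)
    moreover have id: "map_mat of_real A = A" by (intro eq_matI) auto
    ultimately have "norm (1 / lam) \<le> 1"
      by (intro eigenvalue_mat_norm_le_1) (simp only: id)
    then show False using lam by simp
  qed
  then have "B \<in> Units (ring_mat TYPE(real) n ())" by (rule det_non_zero_imp_unit[OF B])
  then obtain C where C: "mat_inverse B = Some C"
    using mat_inverse(1)[OF B] by fastforce
  then have inv: "B * C = 1\<^sub>m n" "C * B = 1\<^sub>m n" "C \<in> carrier_mat n n"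
    using mat_inverse(2)[OF B] by auto
  have CT: "transpose_mat C \<in> carrier_mat n n" and BT: "transpose_mat B \<in> carrier_mat n n"
    and AT: "transpose_mat A \<in> carrier_mat n n" using inv(3) B A by auto
  have BCT: "transpose_mat B * transpose_mat C = 1\<^sub>m n"
    using transpose_mult[OF inv(3) B] inv(2) by simp
  have CBT: "transpose_mat C * transpose_mat B = 1\<^sub>m n"
    using transpose_mult[OF B inv(3)] inv(1) by simp
  \<comment> \<open>Injectivity of the transpose of \<open>B\<close>, for the way back from the
    multiplied equation.\<close>
  have cancel: "x = y" if "x \<in> carrier_vec n" "y \<in> carrier_vec n"
    "transpose_mat B *\<^sub>v x = transpose_mat B *\<^sub>v y" for x y
  proof -
    have id: "transpose_mat C *\<^sub>v (transpose_mat B *\<^sub>v z) = z" if "z \<in> carrier_vec n" for z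
      using assoc_mult_mat_vec[OF CT BT that] CBT that by simp
    have "x = transpose_mat C *\<^sub>v (transpose_mat B *\<^sub>v x)" by (rule id[OF that(1), symmetric])
    also have "\<dots> = transpose_mat C *\<^sub>v (transpose_mat B *\<^sub>v y)" by (simp only: that(3))
    also have "\<dots> = y" by (rule id[OF that(2)])
    finally show ?thesis .
  qed
  have X: "transpose_mat ((1 - lam) \<cdot>\<^sub>m C) *\<^sub>v v = (1 - lam) \<cdot>\<^sub>v (transpose_mat C *\<^sub>v v)"
  proof -
    have "transpose_mat ((1 - lam) \<cdot>\<^sub>m C) = (1 - lam) \<cdot>\<^sub>m transpose_mat C"
      by (intro eq_matI) auto
    then show ?thesis using CT v by (simp add: smult_mat_mult_vec[of _ n n])
  qed
  have BX: "transpose_mat B *\<^sub>v ((1 - lam) \<cdot>\<^sub>v (transpose_mat C *\<^sub>v v)) = (1 - lam) \<cdot>\<^sub>v v"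
  proof -
    have "transpose_mat B *\<^sub>v (transpose_mat C *\<^sub>v v) = v"
      using assoc_mult_mat_vec[OF BT CT v] BCT v by simp
    then show ?thesis using mult_mat_vec[OF BT, of "transpose_mat C *\<^sub>v v"] CT v by simp
  qed
  have Bv: "transpose_mat B *\<^sub>v v = v - lam \<cdot>\<^sub>v (transpose_mat A *\<^sub>v v)"
  proof -
    have "transpose_mat B = 1\<^sub>m n - lam \<cdot>\<^sub>m transpose_mat A"
      using A by (intro eq_matI) (auto simp: B_def)
    then show ?thesis using AT v
      by (simp add: minus_mult_distrib_mat_vec[of _ n n] smult_mat_mult_vec[of _ n n])
  qed
  have "transpose_mat ((1 - lam) \<cdot>\<^sub>m C) *\<^sub>v v = v \<longleftrightarrow>
      transpose_mat B *\<^sub>v v = (1 - lam) \<cdot>\<^sub>v v"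
    (is "?l \<longleftrightarrow> ?r")
  proof
    assume l: ?l
    show ?r using BX[folded X] unfolding l .
  next
    assume r: ?r
    have "(1 - lam) \<cdot>\<^sub>v (transpose_mat C *\<^sub>v v) = v"
      by (rule cancel) (use CT v in \<open>auto simp only: BX r smult_carrier_vec mult_mat_vec_carrier\<close>)
    then show ?l unfolding X .
  qed
  also have "\<dots> \<longleftrightarrow> (\<forall>i<n. v $ i - lam * (transpose_mat A *\<^sub>v v) $ i = (1 - lam) * v $ i)"
    unfolding Bv using AT v by (subst vec_eq_iff) auto
  also have "\<dots> \<longleftrightarrow> (\<forall>i<n. (transpose_mat A *\<^sub>v v) $ i = v $ i)"
    using lam by (auto simp: algebra_simps)
  also have "\<dots> \<longleftrightarrow> transpose_mat A *\<^sub>v v = v"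
    using AT v by (subst vec_eq_iff) auto
  finally show ?thesis using C by (simp add: B_def)
qed

end

section \<open>Convex hulls\<close>

text \<open>Split off one point and rescale the remaining weights by their sum \<open>?s\<close>, so
  that the induction hypothesis applies; binary convexity then mixes the two. If
  \<open>?s = 0\<close>, rescaling is impossible, but all remaining weights vanish and the
  combination is the point \<open>c i\<close>.\<close>

lemma convex_vecs_combination:
  assumes T: "convex_vecs n T" and "finite I" "I \<noteq> {}" "c ` I \<subseteq> T"
    and "\<forall>i\<in>I. 0 \<le> w i" "(\<Sum>i\<in>I. w i) = 1"
  shows "vec n (\<lambda>k. \<Sum>i\<in>I. w i * c i $ k) \<in> T"
  using assms(2-)
proof (induction I arbitrary: w rule: finite_ne_induct)
  case (singleton i)
  have "c i \<in> carrier_vec n" using T singleton by (auto simp: convex_vecs_def)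
  then have "vec n (\<lambda>k. \<Sum>i\<in>{i}. w i * c i $ k) = c i"
    using singleton by (intro eq_vecI) auto
  then show ?case using singleton by simp
next
  case (insert i I)
  let ?s = "\<Sum>i\<in>I. w i"
  have carrier: "c j \<in> carrier_vec n" if "j \<in> insert i I" for j
    using T insert.prems(1) that by (auto simp: convex_vecs_def)
  have s: "w i + ?s = 1" "0 \<le> w i" "0 \<le> ?s"
    using insert by (auto intro: sum_nonneg)
  show ?case
  proof (cases "?s = 0")
    case True
    then have "\<forall>j\<in>I. w j = 0" using insert by (simp add: sum_nonneg_eq_0_iff)
    then have "vec n (\<lambda>k. \<Sum>i\<in>insert i I. w i * c i $ k) = c i"
      using insert.hyps True s carrier[of i] by (intro eq_vecI) auto
    then show ?thesis using insert.prems by simp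
  next
    case False
    let ?u = "vec n (\<lambda>k. \<Sum>j\<in>I. (w j / ?s) * c j $ k)"
    have "?u \<in> T"
      using insert False s by (intro insert.IH) (auto simp flip: sum_divide_distrib)
    then have "w i \<cdot>\<^sub>v c i + ?s \<cdot>\<^sub>v ?u \<in> T"
      using T insert.prems s by (auto simp: convex_vecs_def)
    moreover have "w i \<cdot>\<^sub>v c i + ?s \<cdot>\<^sub>v ?u = vec n (\<lambda>k. \<Sum>i\<in>insert i I. w i * c i $ k)"
      using insert.hyps False carrier[of i]
      by (intro eq_vecI) (auto simp: sum_distrib_left)
    ultimately show ?thesis by simp
  qed
qed

text \<open>Weights belong to indices rather than to points, so coinciding points cause no trouble.
  Every convex superset contains the combinations; conversely, these form a convex set through all
  the points, and the hull is the least such set.\<close>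

lemma convex_hull_vecs_finite_image:
  assumes fin: "finite I" and ne: "I \<noteq> {}" and c: "\<And>i. i \<in> I \<Longrightarrow> c i \<in> carrier_vec n"
  shows "convex_hull_vecs n (c ` I) =
    {vec n (\<lambda>k. \<Sum>i\<in>I. w i * c i $ k) |w. (\<forall>i\<in>I. 0 \<le> w i) \<and> (\<Sum>i\<in>I. w i) = 1}"
    (is "_ = ?H")
proof (rule equalityI)
  show "?H \<subseteq> convex_hull_vecs n (c ` I)"
    using convex_vecs_combination[OF _ fin ne]
    by (fastforce simp: convex_hull_vecs_def hull_def)
  have "c ` I \<subseteq> ?H"
  proof clarify
    fix i assume i: "i \<in> I"
    \<comment> \<open>A single point is the combination that puts all the weight on its own
      index.\<close>
    have "c i = vec n (\<lambda>k. \<Sum>j\<in>I. of_bool (j = i) * c j $ k)"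
      using i fin c[OF i] by (intro eq_vecI) auto
    then show "\<exists>w. c i = vec n (\<lambda>k. \<Sum>j\<in>I. w j * c j $ k) \<and>
        (\<forall>i\<in>I. 0 \<le> w i) \<and> (\<Sum>i\<in>I. w i) = 1"
      using i fin by (intro exI[of _ "\<lambda>j. of_bool (j = i)"]) auto
  qed
  moreover have "convex_vecs n ?H"
    unfolding convex_vecs_def
  proof (intro conjI ballI allI impI)
    show "?H \<subseteq> carrier_vec n" by auto
    fix x y and a b :: real
    assume "x \<in> ?H" "y \<in> ?H" and ab: "0 \<le> a" "0 \<le> b" "a + b = 1"
    then obtain w w' where
      x: "x = vec n (\<lambda>k. \<Sum>i\<in>I. w i * c i $ k)" "\<forall>i\<in>I. 0 \<le> w i" "(\<Sum>i\<in>I. w i) = 1" and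
      y: "y = vec n (\<lambda>k. \<Sum>i\<in>I. w' i * c i $ k)" "\<forall>i\<in>I. 0 \<le> w' i" "(\<Sum>i\<in>I. w' i) = 1"
      by blast
    have "a \<cdot>\<^sub>v x + b \<cdot>\<^sub>v y = vec n (\<lambda>k. \<Sum>i\<in>I. (a * w i + b * w' i) * c i $ k)"
      unfolding x y
      by (intro eq_vecI) (auto simp: sum_distrib_left sum.distrib distrib_right mult.assoc)
    moreover have "(\<Sum>i\<in>I. a * w i + b * w' i) = 1"
      using x y ab by (simp add: sum.distrib flip: sum_distrib_left)
    ultimately show "a \<cdot>\<^sub>v x + b \<cdot>\<^sub>v y \<in> ?H"
      using x y ab by (intro CollectI exI[of _ "\<lambda>i. a * w i + b * w' i"]) auto
  qed
  ultimately show "convex_hull_vecs n (c ` I) \<subseteq> ?H"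
    unfolding convex_hull_vecs_def by (rule hull_minimal)
qed

section \<open>Clusters and stationary vectors of the transition matrix\<close>

text \<open>\<open>pick C\<close> lists \<open>C\<close> in increasing order, so it is inverted by
  counting the smaller elements, the numbering that \<open>extend_by_zero\<close> uses.\<close>

lemma bij_betw_pick:
  assumes "finite C"
  shows "bij_betw (pick C) {..<card C} C"
proof (rule bij_betw_byWitness[where f' = "\<lambda>i. card {k \<in> C. k < i}"])
  show "\<forall>a\<in>{..<card C}. card {k \<in> C. k < pick C a} = a" by (simp add: card_pick_le)
  show "\<forall>i\<in>C. pick C (card {k \<in> C. k < i}) = i" by (simp add: pick_card_in_set)
  show "pick C ` {..<card C} \<subseteq> C" by (auto intro: pick_in_set_le)
  show "(\<lambda>i. card {k \<in> C. k < i}) ` C \<subseteq> {..<card C}"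
    using assms by (auto intro!: psubset_card_mono)
qed

lemma stochastic_kernel_reindex:
  assumes "stochastic_kernel T p" and bij: "bij_betw f S T"
  shows "stochastic_kernel S (\<lambda>i j. p (f i) (f j))"
proof -
  interpret stochastic_kernel T p by fact
  have T: "T = f ` S" using bij by (simp add: bij_betw_def)
  show ?thesis
  proof
    show "finite S" using bij finite_S bij_betw_finite by blast
    show "0 \<le> p (f i) (f j)" if "i \<in> S" "j \<in> S" for i j using that T p_nonneg by blast
    show "(\<Sum>j\<in>S. p (f i) (f j)) = 1" if "i \<in> S" for i
      using that T p_sum[of "f i"] sum.reindex_bij_betw[OF bij, of "p (f i)"] by auto
  qed
qed

section \<open>The transition kernel of a graph without dangling nodes\<close>

locale linked_digraph = pair_fin_digraph G for G :: "nat pair_pre_digraph" +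
  fixes N :: nat
  assumes pverts_eq: "pverts G = {..<N}"
    and no_dangling_node: "\<nexists>u. dangling_node G u"
begin

abbreviation p :: "nat \<Rightarrow> nat \<Rightarrow> real" where
  "p \<equiv> \<lambda>i j. transition_mat G $$ (i, j)"

lemma transition_entry:
  assumes "i < N" "j < N"
  shows "p i j = of_bool ((i, j) \<in> parcs G) / (\<Sum>k<N. of_bool ((i, k) \<in> parcs G))"
  using assms by (simp add: transition_mat_def adjacency_mat_def Let_def pverts_eq of_bool_def)

text \<open>The absence of dangling nodes enters here: it keeps the denominators in
  \<open>transition_mat\<close> away from 0, where division would yield a zero row instead of a
  probability distribution.\<close>

lemma out_degree_pos:
  assumes "i < N"
  shows "0 < (\<Sum>k<N. of_bool ((i, k) \<in> parcs G) :: real)"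
proof -
  obtain k where "(i, k) \<in> parcs G"
    using assms no_dangling_node pverts_eq
    by (auto simp: dangling_node_def out_arcs_def)
  moreover have "k < N" using calculation in_arcsD2 pverts_eq by auto
  ultimately show ?thesis by (intro sum_pos2[of _ k]) auto
qed

lemma p_pos_iff: "i < N \<Longrightarrow> j < N \<Longrightarrow> 0 < p i j \<longleftrightarrow> (i, j) \<in> parcs G"
  using out_degree_pos[of i] by (simp add: transition_entry)

lemma p_eq_0: "i < N \<Longrightarrow> j < N \<Longrightarrow> (i, j) \<notin> parcs G \<Longrightarrow> p i j = 0"
  by (simp add: transition_entry)

lemma parcs_subset_pos: "parcs G \<subseteq> {(i, j). 0 < p i j}"
  using p_pos_iff in_arcsD1 in_arcsD2 pverts_eq by auto

lemma stochastic_mat_transition: "stochastic_mat N (transition_mat G)"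
proof
  show "transition_mat G \<in> carrier_mat N N"
    by (simp add: transition_mat_def Let_def pverts_eq)
  show "0 \<le> p i j" if "i \<in> {..<N}" "j \<in> {..<N}" for i j
    using that out_degree_pos[of i] by (simp add: transition_entry)
  show "(\<Sum>j<N. p i j) = 1" if "i \<in> {..<N}" for i
    using that out_degree_pos[of i] by (simp add: transition_entry card_gt_0_iff flip: sum_divide_distrib)
qed simp

sublocale transition: stochastic_mat N "transition_mat G"
  by (rule stochastic_mat_transition)

lemma pagerank_fixed_iff:
  assumes "0 < lam" "lam < 1" "v \<in> carrier_vec N"
  shows "pagerank G lam v = v \<longleftrightarrow> stationary_on {..<N} p (($) v)"
  using transition.resolvent_fixed_iff[OF assms] stationary_on_iff_transpose[OF transition.A assms(3)]
  by (simp add: pagerank_def resolvent_mat_def Let_def pverts_eq)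

lemma reachable_iff: "u \<rightarrow>\<^sup>*\<^bsub>with_proj G\<^esub> v \<longleftrightarrow> (u, v) \<in> rtrancl_on {..<N} (parcs G)"
  by (simp add: reachable_def pverts_eq)

lemma cluster_subset: "C \<in> clusters G \<Longrightarrow> C \<subseteq> {..<N}"
  using reachable_in_verts(1) pverts_eq by (fastforce simp: in_sccs_verts_conv_reachable)

lemma clusters_disjoint: "C \<in> clusters G \<Longrightarrow> D \<in> clusters G \<Longrightarrow> i \<in> C \<Longrightarrow> i \<in> D \<Longrightarrow> C = D"
  using sccs_verts_disjoint by blast

lemma exists_cluster: "i < N \<Longrightarrow> \<exists>C\<in>clusters G. i \<in> C"
  using scc_of_in_sccs_verts in_scc_of_self pverts_eq by blast

lemma finite_dangling_clusters: "finite (dangling_clusters G)"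
proof (rule finite_subset)
  show "dangling_clusters G \<subseteq> Pow {..<N}"
    using cluster_subset by (auto simp: dangling_clusters_def)
qed simp

text \<open>Some link leads from a node \<open>u\<close> of \<open>C\<close> to a node
  \<open>v\<close> outside. The set \<open>T\<close> of nodes reachable from \<open>v\<close> is
  closed and misses \<open>u\<close>, since otherwise \<open>u\<close> and \<open>v\<close> would
  lie in the same cluster. So \<open>u\<close> feeds a closed set not containing it, and
  \<open>x u = 0\<close>. All nodes of \<open>C\<close> lead to \<open>u\<close>, hence vanish
  too.\<close>

lemma stationary_zero_on_non_dangling:
  assumes x: "stationary_on {..<N} p x" and nonneg: "\<And>i. i < N \<Longrightarrow> 0 \<le> x i"
    and C: "C \<in> non_dangling_clusters G" and i: "i \<in> C"
  shows "x i = 0"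
proof -
  have cl: "C \<in> clusters G" and "C \<notin> dangling_clusters G"
    using C by (auto simp: non_dangling_clusters_def)
  then obtain u v where uv: "(u, v) \<in> parcs G" "u \<in> C" "v \<notin> C"
    by (auto simp: dangling_clusters_def)
  have N: "u < N" "v < N" using uv in_arcsD1 in_arcsD2 pverts_eq by auto
  define T where "T = {w. v \<rightarrow>\<^sup>*\<^bsub>with_proj G\<^esub> w}"
  have T: "T \<subseteq> {..<N}" using reachable_in_verts(2) pverts_eq by (auto simp: T_def)
  have vT: "v \<in> T" using N pverts_eq by (simp add: T_def)
  have closed: "p k l = 0" if "k \<in> T" "l \<in> {..<N} - T" for k l
  proof (rule p_eq_0)
    show "(k, l) \<notin> parcs G"
      using that by (auto simp: T_def reachable_iff intro: rtrancl_on_into_rtrancl_on)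
  qed (use that T in auto)
  have "u \<rightarrow>\<^sup>*\<^bsub>with_proj G\<^esub> v"
    using uv N unfolding reachable_iff
    by (metis lessThan_iff rtrancl_on_into_rtrancl_on rtrancl_on_refl)
  then have "\<not> v \<rightarrow>\<^sup>*\<^bsub>with_proj G\<^esub> u"
    using cl uv by (auto simp: in_sccs_verts_conv_reachable)
  then have "u \<in> {..<N} - T" using N by (simp add: T_def)
  then have "x u = 0"
    using transition.stationary_on_zero_into_closed[OF x _ T closed _ vT] nonneg uv N p_pos_iff
    by auto
  moreover have "(i, u) \<in> rtrancl_on {..<N} {(i, j). 0 < p i j}"
  proof (rule rtrancl_on_mono[OF parcs_subset_pos subset_refl])
    show "(i, u) \<in> rtrancl_on {..<N} (parcs G)"
      using cl i uv(2) by (simp add: in_sccs_verts_conv_reachable reachable_iff)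
  qed
  ultimately show ?thesis
    using transition.stationary_on_zero_backwards[OF x] nonneg by auto
qed

end

section \<open>The Perron vector of one dangling cluster\<close>

locale dangling_cluster = linked_digraph +
  fixes C :: "nat set"
  assumes C: "C \<in> dangling_clusters G"
begin

lemma C_cluster: "C \<in> clusters G" and C_subset: "C \<subseteq> {..<N}" and C_nonempty: "C \<noteq> {}"
  using C cluster_subset by (auto simp: dangling_clusters_def in_sccs_verts_conv_reachable)

lemma C_closed: "i \<in> C \<Longrightarrow> j \<in> {..<N} - C \<Longrightarrow> p i j = 0"
  using C C_subset by (intro p_eq_0) (auto simp: dangling_clusters_def)

text \<open>Strong connectedness provides paths in the whole graph, whereas irreducibility of the
  restricted kernel asks for paths inside \<open>C\<close>. A path that starts in a set closed under
  links never leaves it.\<close>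

lemma reachable_within:
  assumes "(u, v) \<in> rtrancl_on {..<N} (parcs G)" "u \<in> C"
  shows "(u, v) \<in> rtrancl_on C (parcs G) \<and> v \<in> C"
  using assms
proof (induction rule: rtrancl_on_induct)
  case base
  then show ?case by simp
next
  case (step y z)
  moreover have "z \<in> C" using step C by (auto simp: dangling_clusters_def)
  ultimately show ?case by (auto intro: rtrancl_on_into_rtrancl_on)
qed

sublocale cluster: irreducible_stochastic_kernel C p
proof -
  interpret stochastic_kernel C p
    using transition.stochastic_kernel_closed[OF C_subset C_closed] .
  show "irreducible_stochastic_kernel C p"
  proof
    fix i j assume ij: "i \<in> C" "j \<in> C"
    then have "(i, j) \<in> rtrancl_on {..<N} (parcs G)"
      using C_cluster by (simp add: in_sccs_verts_conv_reachable reachable_iff)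
    then have "(i, j) \<in> rtrancl_on C (parcs G)"
      using reachable_within ij(1) by blast
    then show "(i, j) \<in> rtrancl_on C {(i, j). 0 < p i j}"
      by (rule rtrancl_on_mono[OF parcs_subset_pos subset_refl])
  qed
qed

abbreviation position :: "nat \<Rightarrow> nat" where
  "position \<equiv> \<lambda>i. card {k \<in> C. k < i}"

lemma cluster_mat_carrier: "cluster_mat G C \<in> carrier_mat (card C) (card C)"
proof -
  have "{i. i < N \<and> i \<in> C} = C" using C_subset by auto
  then show ?thesis using transition.A by (simp add: cluster_mat_def submatrix_def)
qed

lemma cluster_mat_entry:
  assumes "i < card C" "j < card C"
  shows "cluster_mat G C $$ (i, j) = p (pick C i) (pick C j)"
proof -
  have "{i. i < N \<and> i \<in> C} = C" using C_subset by auto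
  then show ?thesis using assms transition.A by (simp add: cluster_mat_def submatrix_index)
qed

lemma stochastic_mat_cluster: "stochastic_mat (card C) (cluster_mat G C)"
proof -
  interpret reindexed: stochastic_kernel "{..<card C}" "\<lambda>i j. p (pick C i) (pick C j)"
    using cluster.stochastic_kernel_axioms bij_betw_pick[OF cluster.finite_S]
    by (rule stochastic_kernel_reindex)
  show ?thesis
    using cluster_mat_carrier reindexed.p_nonneg reindexed.p_sum
    by unfold_locales (auto simp: cluster_mat_entry)
qed

lemma stationary_on_cluster_mat_iff:
  "stationary_on C p (\<lambda>i. q (position i)) \<longleftrightarrow>
    stationary_on {..<card C} (\<lambda>i j. cluster_mat G C $$ (i, j)) q"
  unfolding stationary_on_reindex[OF bij_betw_pick[OF cluster.finite_S]]
  by (intro stationary_on_cong) (auto simp: card_pick_le cluster_mat_entry)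

lemma sum_position: "(\<Sum>i\<in>C. q (position i)) = (\<Sum>i<card C. q i)"
  unfolding sum.reindex_bij_betw[OF bij_betw_pick[OF cluster.finite_S], symmetric]
  by (intro sum.cong) (auto simp: card_pick_le)

lemma position_less: "i \<in> C \<Longrightarrow> position i < card C"
  using cluster.finite_S by (auto intro!: psubset_card_mono)

text \<open>The description inside \<open>left_perron_vec\<close>, with the spectral radius replaced
  by 1 and the eigenvector equation moved to the nodes of \<open>C\<close>, where irreducibility is
  available.\<close>

definition is_perron :: "real vec \<Rightarrow> bool" where
  "is_perron q \<longleftrightarrow> q \<in> carrier_vec (card C) \<and>
    stationary_on C p (\<lambda>i. q $ position i) \<and> (\<forall>i<card C. q $ i > 0) \<and> (\<Sum>i<card C. q $ i) = 1"

text \<open>The cluster matrix is row-stochastic, so its spectral radius is 1 and the Perron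
  equation becomes stationarity.\<close>

lemma left_perron_vec_eq: "left_perron_vec (cluster_mat G C) = (THE q. is_perron q)"
proof -
  interpret stochastic_mat "card C" "cluster_mat G C" by (rule stochastic_mat_cluster)
  have "0 < card C" using C_nonempty cluster.finite_S by (simp add: card_gt_0_iff)
  then have "spectral_radius (map_mat complex_of_real (cluster_mat G C)) = 1"
    by (rule spectral_radius_eq_1)
  moreover have "dim_row (cluster_mat G C) = card C" using A by simp
  ultimately have "(q \<in> carrier_vec (dim_row (cluster_mat G C)) \<and>
     transpose_mat (cluster_mat G C) *\<^sub>v q =
       spectral_radius (map_mat complex_of_real (cluster_mat G C)) \<cdot>\<^sub>v q \<and>
     (\<forall>i<dim_row (cluster_mat G C). q $ i > 0) \<and>
     (\<Sum>i<dim_row (cluster_mat G C). q $ i) = 1) \<longleftrightarrow> is_perron q" for q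
    using stationary_on_iff_transpose[OF A, of q] stationary_on_cluster_mat_iff[of "($) q"]
    by (auto simp: is_perron_def)
  then show ?thesis by (simp add: left_perron_vec_def)
qed

text \<open>A normalised nonnegative stationary vector of the cluster matrix exists; it is not zero,
  so irreducibility makes it positive. Two such vectors have equal mass and therefore agree, so the
  definite description denotes.\<close>

lemma is_perron_left_perron_vec: "is_perron (left_perron_vec (cluster_mat G C))"
proof -
  interpret stochastic_mat "card C" "cluster_mat G C" by (rule stochastic_mat_cluster)
  have card: "0 < card C" using C_nonempty cluster.finite_S by (simp add: card_gt_0_iff)
  obtain x where x: "stationary_on {..<card C} (\<lambda>i j. cluster_mat G C $$ (i, j)) x"
    "\<And>i. i < card C \<Longrightarrow> 0 \<le> x i" "(\<Sum>i<card C. x i) = 1"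
    using exists_stationary[OF card] by blast
  have x': "stationary_on C p (\<lambda>i. x (position i))"
    using x(1) by (simp only: stationary_on_cluster_mat_iff)
  have "\<not> (\<forall>i\<in>C. x (position i) = 0)"
    using sum_position[of x] x(3) by force
  then have pos: "\<forall>i\<in>C. 0 < x (position i)"
    using cluster.stationary_on_nonneg_cases[OF x'] x(2) position_less by blast
  have pos': "0 < x i" if "i < card C" for i
    using pos[rule_format, OF pick_in_set_le[OF that]] card_pick_le[OF that] by simp
  have perron: "is_perron (vec (card C) x)"
    unfolding is_perron_def using x x' pos' position_less
    by (auto simp: stationary_on_def)
  have unique: "q = q'" if q: "is_perron q" and q': "is_perron q'" for q q'
  proof (rule eq_vecI)
    show "dim_vec q = dim_vec q'" using q q' by (auto simp: is_perron_def dest!: carrier_vecD)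
    fix i assume "i < dim_vec q'"
    then have i: "i < card C" using q' by (auto simp: is_perron_def)
    have "q $ position (pick C i) = q' $ position (pick C i)"
      using q q' sum_position[of "($) q"] sum_position[of "($) q'"] pick_in_set_le[OF i]
      by (intro cluster.stationary_on_unique[of "\<lambda>i. q $ position i" "\<lambda>i. q' $ position i"])
        (auto simp: is_perron_def)
    then show "q $ i = q' $ i" using card_pick_le[OF i] by simp
  qed
  show ?thesis unfolding left_perron_vec_eq by (rule theI[of is_perron, OF perron]) (rule unique[OF _ perron])
qed

lemma cluster_perron_vec:
  shows cluster_perron_vec_carrier: "cluster_perron_vec G C \<in> carrier_vec N"
    and cluster_perron_vec_zero: "\<And>i. i < N \<Longrightarrow> i \<notin> C \<Longrightarrow> cluster_perron_vec G C $ i = 0"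
    and cluster_perron_vec_pos: "\<And>i. i \<in> C \<Longrightarrow> 0 < cluster_perron_vec G C $ i"
    and cluster_perron_vec_sum_cluster: "(\<Sum>i\<in>C. cluster_perron_vec G C $ i) = 1"
    and cluster_perron_vec_stationary_cluster: "stationary_on C p (($) (cluster_perron_vec G C))"
proof -
  let ?q = "left_perron_vec (cluster_mat G C)"
  let ?c = "cluster_perron_vec G C"
  note q = is_perron_left_perron_vec[unfolded is_perron_def]
  have eq: "?c = vec N (\<lambda>i. if i \<in> C then ?q $ position i else 0)"
    by (simp add: cluster_perron_vec_def extend_by_zero_def pverts_eq)
  have entry: "?c $ i = ?q $ position i" if "i \<in> C" for i using that C_subset by (auto simp: eq)
  show "?c \<in> carrier_vec N" by (simp add: eq)
  show "?c $ i = 0" if "i < N" "i \<notin> C" for i using that by (simp add: eq)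
  show "0 < ?c $ i" if "i \<in> C" for i using that q position_less by (simp add: entry)
  show "(\<Sum>i\<in>C. ?c $ i) = 1" using q sum_position[of "($) ?q"] by (simp add: entry)
  have "stationary_on C p (($) ?c) \<longleftrightarrow> stationary_on C p (\<lambda>i. ?q $ position i)"
    by (intro stationary_on_cong) (simp_all add: entry)
  then show "stationary_on C p (($) ?c)" using q by simp
qed

lemma cluster_perron_vec_stationary: "stationary_on {..<N} p (($) (cluster_perron_vec G C))"
  using transition.stationary_on_extend_closed[OF cluster_perron_vec_stationary_cluster _ C_subset C_closed]
    cluster_perron_vec_zero by auto

lemma cluster_perron_vec_sum: "(\<Sum>i<N. cluster_perron_vec G C $ i) = 1"
proof -
  have "(\<Sum>i\<in>C. cluster_perron_vec G C $ i) = (\<Sum>i<N. cluster_perron_vec G C $ i)"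
    using C_subset cluster_perron_vec_zero by (intro sum.mono_neutral_left) auto
  then show ?thesis using cluster_perron_vec_sum_cluster by simp
qed

lemma cluster_perron_vec_nonneg: "i < N \<Longrightarrow> 0 \<le> cluster_perron_vec G C $ i"
  using cluster_perron_vec_zero cluster_perron_vec_pos by (cases "i \<in> C") (auto simp: less_imp_le)

text \<open>Both sides are stationary on \<open>C\<close> with the same mass there, so uniqueness
  identifies them. A cluster of mass 0 is covered without a case split.\<close>

lemma stationary_eq_mass_times_perron:
  assumes x: "stationary_on {..<N} p x" and nonneg: "\<And>i. i < N \<Longrightarrow> 0 \<le> x i" and i: "i \<in> C"
  shows "x i = (\<Sum>j\<in>C. x j) * cluster_perron_vec G C $ i"
proof (rule cluster.stationary_on_unique)
  show "stationary_on C p x"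
    using transition.stationary_on_restrict_closed[OF x _ C_subset C_closed] nonneg by auto
  show "stationary_on C p (\<lambda>i. (\<Sum>j\<in>C. x j) * cluster_perron_vec G C $ i)"
    by (rule stationary_on_scale[OF cluster_perron_vec_stationary_cluster])
  show "(\<Sum>i\<in>C. x i) = (\<Sum>i\<in>C. (\<Sum>j\<in>C. x j) * cluster_perron_vec G C $ i)"
    by (simp add: cluster_perron_vec_sum_cluster flip: sum_distrib_left)
qed (rule i)

end

section \<open>Fixed points as mixtures of Perron vectors\<close>

context linked_digraph
begin

lemma dangling_clusterI: "C \<in> dangling_clusters G \<Longrightarrow> dangling_cluster G N C"
  by unfold_locales

lemmas perron_carrier = dangling_cluster.cluster_perron_vec_carrier[OF dangling_clusterI]
  and perron_zero = dangling_cluster.cluster_perron_vec_zero[OF dangling_clusterI]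
  and perron_pos = dangling_cluster.cluster_perron_vec_pos[OF dangling_clusterI]
  and perron_sum = dangling_cluster.cluster_perron_vec_sum[OF dangling_clusterI]
  and perron_nonneg = dangling_cluster.cluster_perron_vec_nonneg[OF dangling_clusterI]
  and perron_stationary = dangling_cluster.cluster_perron_vec_stationary[OF dangling_clusterI]

lemma dangling_cluster_cases:
  assumes "i < N"
  obtains C where "C \<in> dangling_clusters G" "i \<in> C"
  | C where "C \<in> non_dangling_clusters G" "i \<in> C"
  using exists_cluster[OF assms] by (auto simp: non_dangling_clusters_def)

text \<open>Clusters are disjoint and each Perron vector is zero off its own cluster, so only one
  summand survives.\<close>

lemma combination_eq_on_cluster:
  assumes C: "C \<in> dangling_clusters G" and i: "i \<in> C"
  shows "(\<Sum>D\<in>dangling_clusters G. w D * cluster_perron_vec G D $ i) =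
    w C * cluster_perron_vec G C $ i"
proof -
  have "i < N" using C i cluster_subset by (auto simp: dangling_clusters_def)
  moreover have "i \<notin> D" if "D \<in> dangling_clusters G" "D \<noteq> C" for D
    using that C i clusters_disjoint by (auto simp: dangling_clusters_def)
  ultimately have "(\<Sum>D\<in>dangling_clusters G - {C}. w D * cluster_perron_vec G D $ i) = 0"
    by (intro sum.neutral) (auto simp: perron_zero)
  then show ?thesis by (simp add: sum.remove[OF finite_dangling_clusters C])
qed

text \<open>Mixtures of Perron vectors are stationary by linearity. Conversely, a fixed vector is
  decomposed cluster by cluster. The statement includes the case of a single dangling cluster, for
  the sake of the uniqueness claim.\<close>

lemma fixed_points_prob_simplex:
  assumes lam: "0 < lam" "lam < 1" and ne: "dangling_clusters G \<noteq> {}"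
  shows "fixed_points (pagerank G lam) (prob_simplex N) =
    convex_hull_vecs N (cluster_perron_vec G ` dangling_clusters G)"
    (is "?F = _")
proof -
  let ?D = "dangling_clusters G" and ?c = "cluster_perron_vec G"
  let ?comb = "\<lambda>w. vec N (\<lambda>k. \<Sum>C\<in>?D. w C * ?c C $ k)"
  let ?H = "{?comb w |w. (\<forall>C\<in>?D. 0 \<le> w C) \<and> (\<Sum>C\<in>?D. w C) = 1}"
  have hull: "convex_hull_vecs N (?c ` ?D) = ?H"
    using finite_dangling_clusters ne perron_carrier by (rule convex_hull_vecs_finite_image)
  have sum_comb: "(\<Sum>i<N. \<Sum>C\<in>?D. w C * ?c C $ i) = (\<Sum>C\<in>?D. w C)" for w
  proof -
    have "(\<Sum>i<N. \<Sum>C\<in>?D. w C * ?c C $ i) = (\<Sum>C\<in>?D. w C * (\<Sum>i<N. ?c C $ i))"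
      by (subst sum.swap) (simp add: sum_distrib_left)
    then show ?thesis by (simp add: perron_sum)
  qed
  have "?comb w \<in> ?F" if w: "\<forall>C\<in>?D. 0 \<le> w C" "(\<Sum>C\<in>?D. w C) = 1" for w
  proof -
    have "stationary_on {..<N} p (\<lambda>k. \<Sum>C\<in>?D. w C * ?c C $ k)"
      by (intro stationary_on_sum stationary_on_scale perron_stationary)
    then have "stationary_on {..<N} p (($) (?comb w))"
      by (subst stationary_on_cong[where q = p and y = "\<lambda>k. \<Sum>C\<in>?D. w C * ?c C $ k"]) auto
    moreover have "0 \<le> (\<Sum>C\<in>?D. w C * ?c C $ i)" if "i < N" for i
      using w that by (intro sum_nonneg mult_nonneg_nonneg perron_nonneg) auto
    ultimately show ?thesis
      using w sum_comb by (simp add: fixed_points_def prob_simplex_def pagerank_fixed_iff[OF lam])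
  qed
  moreover have "x \<in> ?H" if x: "x \<in> ?F" for x
  proof -
    have carrier: "x \<in> carrier_vec N" and sum: "(\<Sum>i<N. x $ i) = 1"
      and nonneg: "\<And>i. i < N \<Longrightarrow> 0 \<le> x $ i"
      using x by (auto simp: fixed_points_def prob_simplex_def)
    have stat: "stationary_on {..<N} p (($) x)"
      using x pagerank_fixed_iff[OF lam carrier] by (simp add: fixed_points_def)
    \<comment> \<open>The only possible weights: each Perron vector has mass 1 on its cluster, so
      the coefficient must be the mass of \<open>x\<close> there.\<close>
    define w where "w C = (\<Sum>j\<in>C. x $ j)" for C
    have entry: "x $ i = (\<Sum>C\<in>?D. w C * ?c C $ i)" if i: "i < N" for i
      using i
    proof (cases rule: dangling_cluster_cases)
      case (1 C)
      then have "x $ i = w C * ?c C $ i"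
        unfolding w_def
        by (intro dangling_cluster.stationary_eq_mass_times_perron[OF dangling_clusterI] stat nonneg)
      then show ?thesis using 1 by (simp only: combination_eq_on_cluster)
    next
      case (2 C)
      then have "i \<notin> D" if "D \<in> ?D" for D
        using that clusters_disjoint[of C D i] by (auto simp: non_dangling_clusters_def dangling_clusters_def)
      then have "(\<Sum>C\<in>?D. w C * ?c C $ i) = 0"
        using i by (intro sum.neutral) (auto simp: perron_zero)
      then show ?thesis using stationary_zero_on_non_dangling[OF stat nonneg] 2 by simp
    qed
    show ?thesis
    proof (intro CollectI exI conjI ballI)
      show "x = ?comb w" using carrier entry by (intro eq_vecI) auto
      show "0 \<le> w C" if "C \<in> ?D" for C
        using that nonneg cluster_subset unfolding w_def
        by (intro sum_nonneg) (auto simp: dangling_clusters_def)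
      \<comment> \<open>Each Perron vector has total mass 1, so the weights of a mixture add up to
        its total mass.\<close>
      have "(\<Sum>C\<in>?D. w C) = (\<Sum>i<N. x $ i)"
        unfolding sum_comb[of w, symmetric] by (intro sum.cong) (simp_all add: entry)
      then show "(\<Sum>C\<in>?D. w C) = 1" using sum by simp
    qed
  qed
  ultimately show ?thesis unfolding hull by blast
qed

lemma fixed_points_open_prob_simplex:
  "fixed_points f (open_prob_simplex n) = open_prob_simplex n \<inter> fixed_points f (prob_simplex n)"
  by (auto simp: fixed_points_def open_prob_simplex_def prob_simplex_def less_imp_le)

lemma perron_mem_fixed_points:
  assumes "0 < lam" "lam < 1" "C \<in> dangling_clusters G"
  shows "cluster_perron_vec G C \<in> fixed_points (pagerank G lam) (prob_simplex N)"
  using assms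
  by (simp add: fixed_points_def prob_simplex_def pagerank_fixed_iff perron_carrier perron_sum
      perron_nonneg perron_stationary)

text \<open>A Perron vector is positive exactly on its cluster, so its support recovers the cluster.
  Distinct dangling clusters thus yield distinct fixed points.\<close>

lemma inj_on_cluster_perron_vec: "inj_on (cluster_perron_vec G) (dangling_clusters G)"
proof (rule inj_onI)
  fix C D assume CD: "C \<in> dangling_clusters G" "D \<in> dangling_clusters G"
    and eq: "cluster_perron_vec G C = cluster_perron_vec G D"
  interpret dangling_cluster G N C using CD(1) by (rule dangling_clusterI)
  obtain i where i: "i \<in> C" using C_nonempty by blast
  have "i \<in> D"
  proof (rule ccontr)
    assume "i \<notin> D"
    then have "cluster_perron_vec G D $ i = 0" using perron_zero[OF CD(2)] i C_subset by auto
    then show False using cluster_perron_vec_pos[OF i] eq by simp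
  qed
  then show "C = D" using CD i clusters_disjoint[of C D i] by (auto simp: dangling_clusters_def)
qed

text \<open>Each dangling cluster contributes its own fixed point, so uniqueness leaves room for
  only one; with one cluster, the sole weight is 1 and the hull is a single vector.\<close>

lemma fixed_point_unique_iff:
  assumes lam: "0 < lam" "lam < 1" and ne: "dangling_clusters G \<noteq> {}"
  shows "(\<exists>!v. v \<in> fixed_points (pagerank G lam) (prob_simplex N)) \<longleftrightarrow>
    card (dangling_clusters G) = 1"
proof
  assume unique: "\<exists>!v. v \<in> fixed_points (pagerank G lam) (prob_simplex N)"
  obtain C where C: "C \<in> dangling_clusters G" using ne by blast
  have "D = C" if "D \<in> dangling_clusters G" for D
    using unique that C perron_mem_fixed_points[OF lam] inj_onD[OF inj_on_cluster_perron_vec]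
    by metis
  then have "dangling_clusters G = {C}" using C by blast
  then show "card (dangling_clusters G) = 1" by simp
next
  assume "card (dangling_clusters G) = 1"
  then obtain C where D: "dangling_clusters G = {C}" by (auto simp: card_1_singleton_iff)
  have "vec N (\<lambda>k. \<Sum>D\<in>{C}. w D * cluster_perron_vec G D $ k) = cluster_perron_vec G C"
    if "(\<Sum>D\<in>{C}. w D) = 1" for w
    using that perron_carrier[of C] D by (intro eq_vecI) auto
  moreover have "fixed_points (pagerank G lam) (prob_simplex N) =
      {vec N (\<lambda>k. \<Sum>D\<in>{C}. w D * cluster_perron_vec G D $ k) |w.
        (\<forall>D\<in>{C}. 0 \<le> w D) \<and> (\<Sum>D\<in>{C}. w D) = 1}"
    unfolding fixed_points_prob_simplex[OF lam ne] D
    by (rule convex_hull_vecs_finite_image) (use perron_carrier D in auto)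
  ultimately have "v = cluster_perron_vec G C"
    if "v \<in> fixed_points (pagerank G lam) (prob_simplex N)" for v
    using that by auto
  then show "\<exists>!v. v \<in> fixed_points (pagerank G lam) (prob_simplex N)"
    using perron_mem_fixed_points[OF lam, of C] D by blast
qed

text \<open>A non-dangling cluster forces zero entries on every fixed point. If there is none, the
  dangling clusters cover all nodes, and a mixture in which each has positive weight is positive
  everywhere.\<close>

lemma positive_fixed_point_iff:
  assumes lam: "0 < lam" "lam < 1" and ne: "dangling_clusters G \<noteq> {}"
  shows "fixed_points (pagerank G lam) (open_prob_simplex N) \<noteq> {} \<longleftrightarrow>
    non_dangling_clusters G = {}"
proof
  assume "fixed_points (pagerank G lam) (open_prob_simplex N) \<noteq> {}"
  then obtain x where x: "x \<in> carrier_vec N" "\<And>i. i < N \<Longrightarrow> 0 < x $ i" "pagerank G lam x = x"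
    by (auto simp: fixed_points_def open_prob_simplex_def)
  have stat: "stationary_on {..<N} p (($) x)" using x pagerank_fixed_iff[OF lam] by simp
  show "non_dangling_clusters G = {}"
  proof (rule ccontr)
    assume "non_dangling_clusters G \<noteq> {}"
    then obtain C where C: "C \<in> non_dangling_clusters G" by blast
    then have cl: "C \<in> clusters G" by (simp add: non_dangling_clusters_def)
    then have "C \<noteq> {}" by (simp add: in_sccs_verts_conv_reachable)
    then obtain i where i: "i \<in> C" "i < N" using cluster_subset[OF cl] by auto
    have "x $ i = 0"
      by (rule stationary_zero_on_non_dangling[OF stat less_imp_le[OF x(2)] C i(1)])
    then show False using x(2)[OF i(2)] by simp
  qed
next
  let ?D = "dangling_clusters G"
  assume none: "non_dangling_clusters G = {}"
  \<comment> \<open>Equal weights are just a convenient choice of positive weights with sum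
    1.\<close>
  let ?w = "\<lambda>C. 1 / real (card ?D)"
  let ?x = "vec N (\<lambda>k. \<Sum>C\<in>?D. ?w C * cluster_perron_vec G C $ k)"
  have card: "0 < card ?D" using ne finite_dangling_clusters by (simp add: card_gt_0_iff)
  have "?x \<in> convex_hull_vecs N (cluster_perron_vec G ` ?D)"
    using convex_hull_vecs_finite_image[OF finite_dangling_clusters ne perron_carrier] card
    by (auto intro!: exI[of _ ?w])
  moreover have "0 < ?x $ i" if i: "i < N" for i
    using i
  proof (cases rule: dangling_cluster_cases)
    case (1 C)
    then show ?thesis
      using i card perron_pos by (simp add: combination_eq_on_cluster del: times_divide_eq_left)
  next
    case 2
    then show ?thesis using none by simp
  qed
  ultimately have "?x \<in> fixed_points (pagerank G lam) (open_prob_simplex N)"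
    unfolding fixed_points_open_prob_simplex fixed_points_prob_simplex[OF lam ne, symmetric]
    by (auto simp: open_prob_simplex_def prob_simplex_def fixed_points_def)
  then show "fixed_points (pagerank G lam) (open_prob_simplex N) \<noteq> {}" by blast
qed

end

theorem corollary5:
  fixes G :: "nat pair_pre_digraph" and N M :: nat and lam :: real
  assumes "pair_fin_digraph G" and "pverts G = {..<N}"
    and "\<nexists>u. dangling_node G u"
    and "\<not> strongly_connected (with_proj G)"
    and "card (dangling_clusters G) = M" and "M \<ge> 1"
    and "0 < lam" and "lam < 1"
  shows "(fixed_points (pagerank G lam) (open_prob_simplex N) \<noteq> {} \<longleftrightarrow>
        non_dangling_clusters G = {}) \<and>
    (non_dangling_clusters G \<noteq> {} \<longrightarrow>
        fixed_points (pagerank G lam) (prob_simplex N) \<noteq> {}) \<and>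
    ((\<exists>!v. v \<in> fixed_points (pagerank G lam) (prob_simplex N)) \<longleftrightarrow> M = 1) \<and>
    (M > 1 \<longrightarrow>
      fixed_points (pagerank G lam) (prob_simplex N) =
        convex_hull_vecs N (cluster_perron_vec G ` dangling_clusters G) \<and>
      fixed_points (pagerank G lam) (open_prob_simplex N) =
        open_prob_simplex N \<inter> convex_hull_vecs N (cluster_perron_vec G ` dangling_clusters G))"
proof -
  interpret linked_digraph G N
    using assms(1-3) by (simp add: linked_digraph_def linked_digraph_axioms_def)
  have ne: "dangling_clusters G \<noteq> {}" using assms(5,6) by auto
  note fixed = fixed_points_prob_simplex[OF assms(7,8) ne]
  have "fixed_points (pagerank G lam) (prob_simplex N) \<noteq> {}"
    using ne perron_mem_fixed_points[OF assms(7,8)] by blast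
  then show ?thesis
    using positive_fixed_point_iff[OF assms(7,8) ne] fixed_point_unique_iff[OF assms(7,8) ne]
      fixed assms(5) by (simp add: fixed_points_open_prob_simplex)
qed

end
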